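(* Consider the following game on $[2n]$. Let $X$ be a uniformly random bit. If $X=0$, every sample is drawn from the uniform distribution on $[2n]$. If $X=1$, pair the elements as $\{1,2\},\{3,4\},\dots,\{2n-1,2n\}$ and for each pair $\{2i-1,2i\}$ pick an independent uniformly random $Y_i\in\{\pm1\}$; if $Y_i=1$ put $2i-1$ in set 1 and $2i$ in set 2, otherwise put $2i$ in set 1 and $2i-1$ in set 2. At each step $t$ the player chooses $W_t\in[2n]$; set $Z_t=1$ if $W_t$ is in set 1 and $Z_t=-1$ otherwise, and the $t$-th sample is drawn from the distribution $p$ with $(p_{2i-1},p_{2i})=\left(\frac{1+Y_iZ_t}{2n},\frac{1-Y_iZ_t}{2n}\right)$ for all $i$ (when $X=0$ the choice of $W_t$ has no effect). Let $\mathcal A$ be an algorithm that accesses the samples in a single-pass streaming fashion using $M$ bits of space and $T$ samples, choosing $W_t$ at each step, and determines $X$ with error probability at most $1/3$. Then $T\cdot M=\Omega(n)$. *)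

theory Defs
  imports "HOL-Probability.Probability"
begin

definition pair_signs :: "nat \<Rightarrow> (nat \<Rightarrow> real) pmf" where
  "pair_signs n = Pi_pmf {1..n} 0 (\<lambda>_. pmf_of_set {-1, 1})"

definition set1 :: "nat \<Rightarrow> (nat \<Rightarrow> real) \<Rightarrow> nat set" where
  "set1 n Y = {2 * i - 1 | i. i \<in> {1..n} \<and> Y i = 1} \<union> {2 * i | i. i \<in> {1..n} \<and> Y i \<noteq> 1}"

definition query_sign :: "nat \<Rightarrow> (nat \<Rightarrow> real) \<Rightarrow> nat \<Rightarrow> real" where
  "query_sign n Y w = (if w \<in> set1 n Y then 1 else -1)"

text \<open>For \<open>j = 2 * i - 1\<close> as well as for \<open>j = 2 * i\<close>, the index \<open>i\<close> of the pair containing \<open>j\<close>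
  is \<open>(j + 1) div 2\<close>.\<close>

definition paired_density :: "nat \<Rightarrow> (nat \<Rightarrow> real) \<Rightarrow> real \<Rightarrow> nat \<Rightarrow> real" where
  "paired_density n Y z j =
     (if j \<notin> {1..2 * n} then 0
      else if odd j then (1 + Y ((j + 1) div 2) * z) / (2 * real n)
      else (1 - Y ((j + 1) div 2) * z) / (2 * real n))"

definition paired_sample :: "nat \<Rightarrow> (nat \<Rightarrow> real) \<Rightarrow> nat \<Rightarrow> nat pmf" where
  "paired_sample n Y w = embed_pmf (paired_density n Y (query_sign n Y w))"

text \<open>The sampling oracle maps the player's choice to the distribution of the next sample. The
  oracle itself is random through the signs, which are drawn once and kept for all steps.\<close>

definition sample_oracle :: "nat \<Rightarrow> bool \<Rightarrow> (nat \<Rightarrow> nat pmf) pmf" where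
  "sample_oracle n X =
     (if X then map_pmf (paired_sample n) (pair_signs n)
      else return_pmf (\<lambda>_. pmf_of_set {1..2 * n}))"

text \<open>A deterministic streaming algorithm. The only information carried from one step to the next
  is the memory contents, a bit string; the choice and the update at a step may also depend on the
  index of the step (which is not charged to the memory). The guess \<open>True\<close> stands for \<open>X = 1\<close>.\<close>

record streaming_alg =
  initial :: "bool list"
  choice :: "nat \<Rightarrow> bool list \<Rightarrow> nat"
  step :: "nat \<Rightarrow> bool list \<Rightarrow> nat \<Rightarrow> bool list"
  guess :: "bool list \<Rightarrow> bool"

definition uses_bits :: "nat \<Rightarrow> nat \<Rightarrow> streaming_alg \<Rightarrow> bool" where
  "uses_bits n M A \<longleftrightarrow>
     length (initial A) = M \<and>
     (\<forall>t s. length s = M \<longrightarrow>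
        choice A t s \<in> {1..2 * n} \<and> (\<forall>j\<in>{1..2 * n}. length (step A t s j) = M))"

fun memory_after :: "(nat \<Rightarrow> nat pmf) \<Rightarrow> streaming_alg \<Rightarrow> nat \<Rightarrow> bool list pmf" where
  "memory_after S A 0 = return_pmf (initial A)"
| "memory_after S A (Suc t) = do {
     s \<leftarrow> memory_after S A t;
     j \<leftarrow> S (choice A t s);
     return_pmf (step A t s j)
   }"

text \<open>A randomized algorithm is a probability distribution on deterministic ones. This covers fresh
  coins at every step, since a step is executed only once and its coins may be tossed in advance,
  as well as a random string that stays accessible without being charged to the memory.\<close>

definition streaming_game :: "nat \<Rightarrow> nat \<Rightarrow> streaming_alg pmf \<Rightarrow> (bool \<times> bool) pmf" where
  "streaming_game n T \<A> = do {
     X \<leftarrow> pmf_of_set (UNIV :: bool set);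
     S \<leftarrow> sample_oracle n X;
     A \<leftarrow> \<A>;
     s \<leftarrow> memory_after S A T;
     return_pmf (X, guess A s)
   }"

definition error_prob :: "nat \<Rightarrow> nat \<Rightarrow> streaming_alg pmf \<Rightarrow> real" where
  "error_prob n T \<A> = measure_pmf.prob (streaming_game n T \<A>) {(X, g). g \<noteq> X}"

lemma sum_paired:
  fixes f :: "nat \<Rightarrow> real"
  shows "(\<Sum>j\<in>{1..2 * n}. f j) = (\<Sum>i\<in>{1..n}. f (2 * i - 1) + f (2 * i))"
  by (induction n) auto

text \<open>The argument of \<open>embed_pmf\<close> is indeed a probability mass function.\<close>

lemma pmf_paired_sample:
  assumes "n \<ge> 1" and "Y \<in> set_pmf (pair_signs n)"
  shows "pmf (paired_sample n Y w) j = paired_density n Y (query_sign n Y w) j"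
proof -
  define z where "z = query_sign n Y w"
  have z: "z = 1 \<or> z = -1"
    by (simp add: z_def query_sign_def)
  have Y: "Y i = 1 \<or> Y i = -1" if "i \<in> {1..n}" for i
    using assms(2) that by (auto simp: pair_signs_def set_Pi_pmf PiE_dflt_def)
  have nonneg: "paired_density n Y z j \<ge> 0" for j
  proof (cases "j \<in> {1..2 * n}")
    case True
    then have "(j + 1) div 2 \<in> {1..n}" by auto
    with Y z show ?thesis by (fastforce simp: paired_density_def)
  qed (auto simp: paired_density_def)
  have pair: "paired_density n Y z (2 * i - 1) + paired_density n Y z (2 * i) = 1 / real n"
    if "i \<in> {1..n}" for i
  proof -
    obtain k where "i = Suc k" using \<open>i \<in> {1..n}\<close> by (cases i) auto
    with that show ?thesis by (auto simp: paired_density_def field_simps)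
  qed
  have "(\<integral>\<^sup>+ j. ennreal (paired_density n Y z j) \<partial>count_space UNIV)
      = (\<Sum>j\<in>{1..2 * n}. ennreal (paired_density n Y z j))"
    by (rule nn_integral_count_space') (auto simp: paired_density_def)
  also have "\<dots> = ennreal (\<Sum>j\<in>{1..2 * n}. paired_density n Y z j)"
    by (simp add: nonneg)
  also have "(\<Sum>j\<in>{1..2 * n}. paired_density n Y z j) = 1"
  proof -
    have "(\<Sum>j\<in>{1..2 * n}. paired_density n Y z j) = (\<Sum>i\<in>{1..n}. 1 / real n)"
      unfolding sum_paired by (rule sum.cong[OF refl pair])
    then show ?thesis using assms(1) by simp
  qed
  finally show ?thesis
    unfolding paired_sample_def z_def[symmetric] by (intro pmf_embed_pmf nonneg) simp
qed

end

theory Submission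
  imports Defs
begin

text \<open>
  It suffices to treat a deterministic algorithm. Let \<open>p\<^sub>t\<close> and \<open>q\<^sub>t\<close> be the laws of the memory after
  \<open>t\<close> steps for \<open>X = 1\<close> (averaged over the signs \<open>Y\<close>) and for \<open>X = 0\<close>. By the chain rule and data
  processing, the relative entropy of \<open>p\<^sub>t\<close> with respect to \<open>q\<^sub>t\<close> grows in one step by at most the
  expectation over \<open>s \<sim> p\<^sub>t\<close> of \<open>1/n \<cdot> \<Sum>\<^sub>i E[Y\<^sub>i Y\<^sub>k | s]\<^sup>2\<close>, where \<open>k\<close> is the pair queried in
  memory state \<open>s\<close>. Conditioning on \<open>s\<close> changes the uniform measure on signs by a density at most
  \<open>1/p\<^sub>t(s)\<close>, so comparing moment generating functions bounds the sum of squares by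
  \<open>1 + 2 ln (2/p\<^sub>t(s))\<close>. Its expectation is \<open>O(1 + M)\<close>, since the entropy of \<open>M\<close> bits is at most
  \<open>M ln 2\<close>. After \<open>T\<close> steps the relative entropy is thus \<open>O(T (1 + M) / n)\<close>, whereas error at most
  \<open>1/3\<close> forces it to be bounded below by a constant.
\<close>

section \<open>Relative entropy on finite sets\<close>

text \<open>The tangent bound \<open>ln z \<le> z - 1\<close> at \<open>z = c * y / x\<close>. The
  free parameter \<open>c\<close> is tuned in each use: a ratio of total masses for the log-sum
  inequality, one over the cardinality for the entropy bound, and a two-valued function for the
  lower bound from a gap.\<close>

lemma mult_ln_divide_ge:
  fixes x y c :: real
  assumes "x \<ge> 0" "y \<ge> 0" "y = 0 \<Longrightarrow> x = 0" "c > 0"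
  shows "x * ln c + x - c * y \<le> x * ln (x / y)"
proof (cases "x = 0")
  case True
  then show ?thesis using assms by simp
next
  case False
  then have pos: "x > 0" "y > 0" using assms by force+
  have "ln (c * y / x) \<le> c * y / x - 1"
    using pos assms(4) by (intro ln_le_minus_one) auto
  then have "x * ln (c * y / x) \<le> x * (c * y / x - 1)"
    using pos by (intro mult_left_mono) auto
  moreover have "ln (c * y / x) = ln c - ln (x / y)"
    using pos assms(4) by (simp add: ln_div ln_mult)
  ultimately show ?thesis
    using pos by (simp add: algebra_simps)
qed

definition rel_entropy :: "'a set \<Rightarrow> ('a \<Rightarrow> real) \<Rightarrow> ('a \<Rightarrow> real) \<Rightarrow> real" where
  "rel_entropy A p q = (\<Sum>x\<in>A. p x * ln (p x / q x))"

lemma log_sum_inequality: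
  assumes "finite A"
    and "\<And>x. x \<in> A \<Longrightarrow> p x \<ge> 0" "\<And>x. x \<in> A \<Longrightarrow> q x \<ge> 0"
    and "\<And>x. x \<in> A \<Longrightarrow> q x = 0 \<Longrightarrow> p x = 0"
  shows "sum p A * ln (sum p A / sum q A) \<le> rel_entropy A p q"
proof (cases "sum p A = 0")
  case True
  then have "p x = 0" if "x \<in> A" for x
    using assms that by (simp add: sum_nonneg_eq_0_iff)
  then show ?thesis using True by (simp add: rel_entropy_def)
next
  case False
  then have p: "sum p A > 0" using assms(2) by (simp add: sum_nonneg order_less_le)
  have "sum q A \<noteq> 0"
  proof
    assume "sum q A = 0"
    then have "q x = 0" if "x \<in> A" for x
      using assms that by (simp add: sum_nonneg_eq_0_iff)
    with assms(4) False show False by (auto intro: sum.neutral)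
  qed
  then have q: "sum q A > 0" using assms(3) by (simp add: sum_nonneg order_less_le)
  \<comment> \<open>With the ratio of the totals as slope, the terms \<open>p x - ?c * q x\<close>
    sum to zero.\<close>
  let ?c = "sum p A / sum q A"
  have "sum p A * ln ?c = (\<Sum>x\<in>A. p x * ln ?c + p x - ?c * q x)"
    unfolding sum.distrib sum_subtractf sum_distrib_right[symmetric] sum_distrib_left[symmetric]
    using q by simp
  also have "\<dots> \<le> rel_entropy A p q"
    unfolding rel_entropy_def using assms p q by (intro sum_mono mult_ln_divide_ge) auto
  finally show ?thesis .
qed

text \<open>Data processing for a deterministic map: the log-sum inequality on each fibre of
  \<open>g\<close>, followed by regrouping.\<close>

lemma rel_entropy_image_le:
  assumes "finite A" "finite B" "g ` A \<subseteq> B"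
    and "\<And>x. x \<in> A \<Longrightarrow> p x \<ge> 0" "\<And>x. x \<in> A \<Longrightarrow> q x \<ge> 0"
    and "\<And>x. x \<in> A \<Longrightarrow> q x = 0 \<Longrightarrow> p x = 0"
  shows "rel_entropy B (\<lambda>y. \<Sum>x\<in>{x \<in> A. g x = y}. p x) (\<lambda>y. \<Sum>x\<in>{x \<in> A. g x = y}. q x)
      \<le> rel_entropy A p q"
proof -
  have "rel_entropy B (\<lambda>y. \<Sum>x\<in>{x \<in> A. g x = y}. p x) (\<lambda>y. \<Sum>x\<in>{x \<in> A. g x = y}. q x)
      \<le> (\<Sum>y\<in>B. rel_entropy {x \<in> A. g x = y} p q)"
    unfolding rel_entropy_def[of B] using assms by (intro sum_mono log_sum_inequality) auto
  also have "\<dots> = rel_entropy A p q"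
    unfolding rel_entropy_def using assms by (intro sum.group)
  finally show ?thesis .
qed

lemma entropy_le_ln_card:
  assumes "finite A" "\<And>x. x \<in> A \<Longrightarrow> p x \<ge> 0" "sum p A = 1"
  shows "(\<Sum>x\<in>A. p x * ln (1 / p x)) \<le> ln (card A)"
proof -
  have "A \<noteq> {}" using assms(3) by auto
  then have N: "real (card A) > 0" using assms(1) by (simp add: card_gt_0_iff)
  have "p x * ln (1 / p x) \<le> p x * ln (card A) - p x + 1 / card A" if "x \<in> A" for x
    using mult_ln_divide_ge[of "p x" 1 "1 / card A"] assms(2)[OF that] N
    by (auto simp: ln_div algebra_simps)
  then have "(\<Sum>x\<in>A. p x * ln (1 / p x)) \<le> (\<Sum>x\<in>A. p x * ln (card A) - p x + 1 / card A)"
    by (rule sum_mono)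
  also have "\<dots> = ln (card A)"
    using N assms(3) by (simp add: sum.distrib sum_subtractf flip: sum_distrib_right)
  finally show ?thesis .
qed

text \<open>A Pinsker-type bound with explicit constants, obtained from a test function that favours
  \<open>G\<close>.\<close>

lemma rel_entropy_ge_of_gap:
  assumes "finite A" "G \<subseteq> A"
    and "\<And>x. x \<in> A \<Longrightarrow> p x \<ge> 0" "\<And>x. x \<in> A \<Longrightarrow> q x \<ge> 0"
    and "\<And>x. x \<in> A \<Longrightarrow> q x = 0 \<Longrightarrow> p x = 0"
    and "sum p A = 1" "sum q A = 1" and gap: "sum p G - sum q G \<ge> 1 / 3"
  shows "rel_entropy A p q \<ge> 1 / 18"
proof -
  \<comment> \<open>The slopes are 1 + 1/6 on \<open>G\<close> and 1 - 1/6 off it. With a =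
    \<open>sum p G\<close> and b = \<open>sum q G\<close>, the second-order bounds on the logarithms
    give at least (13 a - 12 b - 2) / 36, which is at least 1/18 because a - b \<ge> 1/3 and a \<ge>
    0.\<close>
  define c :: "'a \<Rightarrow> real" where "c = (\<lambda>x. if x \<in> G then 7/6 else 5/6)"
  have split: "sum f A = sum f G + sum f (A - G)" for f :: "'a \<Rightarrow> real"
    using assms(1,2) by (metis add.commute sum.subset_diff)
  have ln: "ln (7/6::real) \<ge> 1/6 - 1/36" "ln (5/6::real) \<ge> - 1/6 - 2/36"
    using ln_one_plus_pos_lower_bound[of "1/6"] ln_one_minus_pos_lower_bound[of "1/6"]
    by (simp_all add: power2_eq_square)
  have pG: "sum p G \<ge> 0" "sum p (A - G) \<ge> 0"
    using assms(2,3) by (auto intro!: sum_nonneg)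
  have "(\<Sum>x\<in>A. p x * ln (c x) + p x - c x * q x) \<le> rel_entropy A p q"
    unfolding rel_entropy_def using assms by (intro sum_mono mult_ln_divide_ge) (auto simp: c_def)
  also have "(\<Sum>x\<in>A. p x * ln (c x) + p x - c x * q x)
      = sum p G * ln (7/6) + sum p (A - G) * ln (5/6) + sum p A
        - (7/6 * sum q G + 5/6 * sum q (A - G))"
    unfolding sum_subtractf sum.distrib split[of "\<lambda>x. p x * ln (c x)"] split[of "\<lambda>x. c x * q x"]
    by (simp add: c_def sum_distrib_right sum_distrib_left)
  finally have *: "sum p G * ln (7/6) + sum p (A - G) * ln (5/6) + sum p A
        - (7/6 * sum q G + 5/6 * sum q (A - G)) \<le> rel_entropy A p q" .
  have "sum p G * (1/6 - 1/36) \<le> sum p G * ln (7/6)"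
    "sum p (A - G) * (- 1/6 - 2/36) \<le> sum p (A - G) * ln (5/6)"
    by (rule mult_left_mono[OF ln(1) pG(1)], rule mult_left_mono[OF ln(2) pG(2)])
  then show ?thesis
    using * gap assms(6,7) split[of p] split[of q] pG by argo
qed

section \<open>Correlations of the hidden signs\<close>

lemma cosh_le_exp_half_square: "cosh a \<le> exp (a\<^sup>2 / 2)" for a :: real
proof -
  have "cosh \<bar>a\<bar> \<le> exp (\<bar>a\<bar>\<^sup>2 / 2)"
  proof -
    define b where "b = \<bar>a\<bar>"
    have pos: "1 + exp (2 * b) > 0" by (simp add: add_pos_pos)
    \<comment> \<open>The left side is ln (cosh b), written as the centred log moment generating
      function of a fair coin at h = 2 b. Hoeffding's bound h^2 / 8 is then b^2 / 2.\<close>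
    have "- b + ln ((1 + exp (2 * b)) / 2) \<le> b\<^sup>2 / 2"
      using Hoeffdings_lemma_aux[of "2 * b" "1/2"] by (simp add: b_def field_simps)
    then have "exp (- b + ln ((1 + exp (2 * b)) / 2)) \<le> exp (b\<^sup>2 / 2)" by simp
    also have "exp (- b + ln ((1 + exp (2 * b)) / 2)) = exp (- b) * ((1 + exp (2 * b)) / 2)"
      using pos by (simp only: exp_add) simp
    also have "\<dots> = cosh b"
      by (simp add: cosh_def field_simps flip: exp_add)
    finally show ?thesis by (simp add: b_def)
  qed
  then show ?thesis by simp
qed

lemma finite_set_pair_signs: "finite (set_pmf (pair_signs n))"
  unfolding pair_signs_def by (auto simp: set_Pi_pmf intro!: finite_PiE_dflt)

lemma integrable_pair_signs [simp]: "integrable (measure_pmf (pair_signs n)) (f :: _ \<Rightarrow> real)"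
  by (rule integrable_measure_pmf_finite[OF finite_set_pair_signs])

lemma pair_signs_cases: "Y i = 1 \<or> Y i = -1" if "Y \<in> set_pmf (pair_signs n)" "i \<in> {1..n}"
  using that by (auto simp: pair_signs_def set_Pi_pmf PiE_dflt_def)

lemma expectation_exp_pair_signs:
  fixes a :: "nat \<Rightarrow> real"
  shows "measure_pmf.expectation (pair_signs n) (\<lambda>Y. exp (\<Sum>i\<in>{1..n}. a i * Y i))
    \<le> exp ((\<Sum>i\<in>{1..n}. (a i)\<^sup>2) / 2)"
proof -
  have "measure_pmf.expectation (pair_signs n) (\<lambda>Y. exp (\<Sum>i\<in>{1..n}. a i * Y i))
      = (\<Prod>i\<in>{1..n}. measure_pmf.expectation (pmf_of_set {-1, 1}) (\<lambda>v. exp (a i * v)))"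
    unfolding pair_signs_def exp_sum[OF finite_atLeastAtMost]
    by (intro expectation_prod_Pi_pmf) (auto intro!: integrable_measure_pmf_finite)
  also have "\<dots> = (\<Prod>i\<in>{1..n}. cosh (a i))"
    by (intro prod.cong) (auto simp: integral_pmf_of_set cosh_def)
  also have "\<dots> \<le> (\<Prod>i\<in>{1..n}. exp ((a i)\<^sup>2 / 2))"
    by (intro prod_mono) (auto intro: cosh_le_exp_half_square less_imp_le)
  also have "\<dots> = exp ((\<Sum>i\<in>{1..n}. (a i)\<^sup>2) / 2)"
    by (simp add: sum_divide_distrib flip: exp_sum)
  finally show ?thesis .
qed

text \<open>In the application \<open>g Y\<close> is the probability of a memory state given the
  signs. Then \<open>P\<close> is its averaged probability, and \<open>C i / P\<close> is the
  correlation of signs \<open>i\<close> and \<open>k\<close> conditioned on that state.\<close>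

lemma pair_correlations_le:
  fixes g :: "(nat \<Rightarrow> real) \<Rightarrow> real" and n k :: nat
  defines "P \<equiv> measure_pmf.expectation (pair_signs n) g"
  defines "C \<equiv> \<lambda>i. measure_pmf.expectation (pair_signs n) (\<lambda>Y. g Y * (Y i * Y k))"
  assumes k: "k \<in> {1..n}" and g: "\<And>Y. 0 \<le> g Y" "\<And>Y. g Y \<le> 1" and P: "P > 0"
  shows "(\<Sum>i\<in>{1..n}. (C i)\<^sup>2) \<le> P\<^sup>2 * (1 + 2 * ln (2 / P))"
proof -
  let ?E = "measure_pmf.expectation (pair_signs n)"
  \<comment> \<open>Taking the conditional correlations themselves as weights makes \<open>v\<close>
    the mean of \<open>Y k * L Y\<close> under the density \<open>g / P\<close>. The index
    \<open>k\<close> is left out: its correlation is exactly 1 and accounts for the summand 1 in the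
    bound.\<close>
  define a where "a i = (if i = k then 0 else C i / P)" for i
  define L where "L Y = (\<Sum>i\<in>{1..n}. a i * Y i)" for Y :: "nat \<Rightarrow> real"
  define v where "v = (\<Sum>i\<in>{1..n}. (a i)\<^sup>2)"
  have aC: "a i * C i = P * (a i)\<^sup>2" for i
    using P by (simp add: a_def power2_eq_square)
  have EL: "?E (\<lambda>Y. g Y * (Y k * L Y)) = P * v"
  proof -
    have "?E (\<lambda>Y. g Y * (Y k * L Y)) = ?E (\<lambda>Y. \<Sum>i\<in>{1..n}. a i * (g Y * (Y i * Y k)))"
      by (simp add: L_def sum_distrib_left mult_ac)
    also have "\<dots> = (\<Sum>i\<in>{1..n}. a i * C i)"
      unfolding C_def by (subst Bochner_Integration.integral_sum) auto
    finally show ?thesis by (simp add: aC v_def sum_distrib_left)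
  qed
  \<comment> \<open>Jensen's inequality for \<open>exp\<close> under the density \<open>g / P\<close>, via the tangent at the mean \<open>v\<close>. The
    factor \<open>Y k\<close> in the exponent is then removed by summing over both of its values, at the cost of a
    factor 2.\<close>
  have "P * exp v = ?E (\<lambda>Y. g Y * (exp v * (1 + (Y k * L Y - v))))"
  proof -
    have "?E (\<lambda>Y. g Y * (exp v * (1 + (Y k * L Y - v))))
      = ?E (\<lambda>Y. exp v * (1 - v) * g Y + exp v * (g Y * (Y k * L Y)))"
      by (simp add: algebra_simps)
    also have "\<dots> = exp v * (1 - v) * P + exp v * (P * v)"
      unfolding P_def EL[unfolded P_def, symmetric]
      by (subst Bochner_Integration.integral_add) auto
    finally show ?thesis by (simp add: algebra_simps)
  qed
  also have "\<dots> \<le> ?E (\<lambda>Y. exp (L Y) + exp (- L Y))"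
  proof (intro integral_mono_AE AE_pmfI)
    fix Y assume Y: "Y \<in> set_pmf (pair_signs n)"
    have "exp v * (1 + (Y k * L Y - v)) \<le> exp v * exp (Y k * L Y - v)"
      by (intro mult_left_mono exp_ge_add_one_self) auto
    also have "\<dots> = exp (Y k * L Y)"
      by (simp flip: exp_add)
    finally have "g Y * (exp v * (1 + (Y k * L Y - v))) \<le> g Y * exp (Y k * L Y)"
      by (intro mult_left_mono g)
    also have "\<dots> \<le> 1 * exp (Y k * L Y)"
      by (intro mult_right_mono g) auto
    also have "\<dots> \<le> exp (L Y) + exp (- L Y)"
      using pair_signs_cases[OF Y k] by auto
    finally show "g Y * (exp v * (1 + (Y k * L Y - v))) \<le> exp (L Y) + exp (- L Y)" .
  qed auto
  also have "\<dots> \<le> exp (v / 2) + exp (v / 2)"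
    using expectation_exp_pair_signs[of n a] expectation_exp_pair_signs[of n "\<lambda>i. - a i"]
    by (subst Bochner_Integration.integral_add) (auto simp: L_def v_def sum_negf)
  finally have "P * exp v \<le> 2 * exp (v / 2)" by simp
  moreover have "exp v = exp (v / 2) * exp (v / 2)" by (simp flip: exp_add)
  ultimately have "exp (v / 2) \<le> 2 / P" using P by (simp add: field_simps)
  then have v: "v \<le> 2 * ln (2 / P)" using P ln_ge_iff[of "2 / P" "v / 2"] by simp
  have "C k = P"
    unfolding C_def P_def
    using pair_signs_cases[OF _ k] by (intro integral_cong_AE AE_pmfI) force+
  then have "(C i)\<^sup>2 = P\<^sup>2 * ((a i)\<^sup>2 + (if i = k then 1 else 0))" for i
    using P by (simp add: a_def power_divide)
  then have "(\<Sum>i\<in>{1..n}. (C i)\<^sup>2) = P\<^sup>2 * (v + 1)"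
    using k by (simp add: v_def sum.distrib flip: sum_distrib_left)
  also have "\<dots> \<le> P\<^sup>2 * (1 + 2 * ln (2 / P))"
    using v by (intro mult_left_mono) auto
  finally show ?thesis .
qed

section \<open>Evolution of the memory\<close>

lemma set_pmf_memory_after:
  assumes "uses_bits n M A" "\<And>w. set_pmf (S w) \<subseteq> {1..2 * n}"
  shows "set_pmf (memory_after S A t) \<subseteq> {s. length s = M}"
proof (induction t)
  case 0
  then show ?case using assms by (simp add: uses_bits_def)
next
  case (Suc t)
  then show ?case using assms unfolding uses_bits_def by (fastforce simp: set_bind_pmf)
qed

lemma finite_bit_strings: "finite {s :: bool list. length s = M}"
  using finite_lists_length_eq[of "UNIV :: bool set" M] by simp

lemma card_bit_strings: "card {s :: bool list. length s = M} = 2 ^ M"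
  using card_lists_length_eq[of "UNIV :: bool set" M] by simp

text \<open>The new law is presented as the image, under the update, of the joint law of old state
  and sample. This sum over fibres is the form to which \<open>rel_entropy_image_le\<close>
  applies.\<close>

lemma pmf_memory_after_Suc:
  fixes n M :: nat
  defines "D \<equiv> {s :: bool list. length s = M} \<times> {1..2 * n}"
  assumes "uses_bits n M A" "\<And>w. set_pmf (S w) \<subseteq> {1..2 * n}"
  shows "pmf (memory_after S A (Suc t)) u =
    (\<Sum>x\<in>{x \<in> D. (\<lambda>(s, j). step A t s j) x = u}.
        (\<lambda>(s, j). pmf (memory_after S A t) s * pmf (S (choice A t s)) j) x)"
proof -
  have "pmf (memory_after S A (Suc t)) u =
    (\<Sum>s\<in>{s. length s = M}. (\<Sum>j\<in>{1..2 * n}. (if step A t s j = u then 1 else 0)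
        * pmf (S (choice A t s)) j) * pmf (memory_after S A t) s)"
  proof -
    have inner: "measure_pmf.expectation (S w) (\<lambda>j. pmf (return_pmf (step A t s j)) u)
       = (\<Sum>j\<in>{1..2 * n}. (if step A t s j = u then 1 else 0) * pmf (S w) j)" for s w
    proof -
      have "measure_pmf.expectation (S w) (\<lambda>j. pmf (return_pmf (step A t s j)) u)
          = (\<Sum>j\<in>{1..2 * n}. pmf (return_pmf (step A t s j)) u * pmf (S w) j)"
        using assms(3)[of w] by (intro integral_measure_pmf_real) auto
      also have "\<dots> = (\<Sum>j\<in>{1..2 * n}. (if step A t s j = u then 1 else 0) * pmf (S w) j)"
        by (intro sum.cong) (simp_all add: indicator_def)
      finally show ?thesis .
    qed
    have "set_pmf (memory_after S A t) \<subseteq> {s. length s = M}"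
      using assms(2,3) by (rule set_pmf_memory_after)
    then show ?thesis
      unfolding memory_after.simps pmf_bind inner
      by (intro integral_measure_pmf_real finite_bit_strings) blast
  qed
  also have "\<dots> = (\<Sum>(s, j)\<in>D. if step A t s j = u
      then pmf (memory_after S A t) s * pmf (S (choice A t s)) j else 0)"
    unfolding D_def sum_distrib_right sum.cartesian_product by (intro sum.cong) auto
  also have "\<dots> = (\<Sum>x\<in>{x \<in> D. (\<lambda>(s, j). step A t s j) x = u}.
        (\<lambda>(s, j). pmf (memory_after S A t) s * pmf (S (choice A t s)) j) x)"
    using finite_bit_strings[of M] unfolding D_def
    by (subst sum.inter_filter) (auto intro!: sum.cong)
  finally show ?thesis .
qed

section \<open>Memory laws under the two hypotheses\<close>

definition null_memory :: "nat \<Rightarrow> streaming_alg \<Rightarrow> nat \<Rightarrow> bool list pmf" where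
  "null_memory n A t = memory_after (\<lambda>_. pmf_of_set {1..2 * n}) A t"

definition paired_memory :: "nat \<Rightarrow> streaming_alg \<Rightarrow> nat \<Rightarrow> bool list pmf" where
  "paired_memory n A t = pair_signs n \<bind> (\<lambda>Y. memory_after (paired_sample n Y) A t)"

text \<open>The joint, not the conditional, probability of state \<open>s\<close> after
  \<open>t\<close> steps and sample \<open>j\<close> when X = 1. The expectation is outside the
  product because the same signs govern past and next samples.\<close>

definition next_sample :: "nat \<Rightarrow> streaming_alg \<Rightarrow> nat \<Rightarrow> bool list \<Rightarrow> nat \<Rightarrow> real" where
  "next_sample n A t s j = measure_pmf.expectation (pair_signs n)
     (\<lambda>Y. pmf (memory_after (paired_sample n Y) A t) s * pmf (paired_sample n Y (choice A t s)) j)"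

lemma set_pmf_paired_sample:
  assumes "n \<ge> 1" "Y \<in> set_pmf (pair_signs n)"
  shows "set_pmf (paired_sample n Y w) \<subseteq> {1..2 * n}"
proof
  fix j assume "j \<in> set_pmf (paired_sample n Y w)"
  then show "j \<in> {1..2 * n}"
    using pmf_paired_sample[OF assms, of w j]
    by (auto simp: set_pmf_eq paired_density_def split: if_splits)
qed

lemma set_pmf_paired_memory:
  assumes "n \<ge> 1" "uses_bits n M A"
  shows "set_pmf (paired_memory n A t) \<subseteq> {s. length s = M}"
proof -
  have "set_pmf (memory_after (paired_sample n Y) A t) \<subseteq> {s. length s = M}"
    if "Y \<in> set_pmf (pair_signs n)" for Y
    using assms(2) set_pmf_paired_sample[OF assms(1) that] by (rule set_pmf_memory_after)
  then show ?thesis by (auto simp: paired_memory_def)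
qed

lemma set_pmf_null_memory:
  assumes "n \<ge> 1" "uses_bits n M A"
  shows "set_pmf (null_memory n A t) \<subseteq> {s. length s = M}"
  unfolding null_memory_def using assms by (intro set_pmf_memory_after) auto

lemma pmf_paired_memory:
  "pmf (paired_memory n A t) s =
    measure_pmf.expectation (pair_signs n) (\<lambda>Y. pmf (memory_after (paired_sample n Y) A t) s)"
  by (simp add: paired_memory_def pmf_bind)

lemma pmf_paired_memory_Suc:
  fixes n M :: nat
  defines "D \<equiv> {s :: bool list. length s = M} \<times> {1..2 * n}"
  assumes "n \<ge> 1" "uses_bits n M A"
  shows "pmf (paired_memory n A (Suc t)) u =
    (\<Sum>x\<in>{x \<in> D. (\<lambda>(s, j). step A t s j) x = u}. (\<lambda>(s, j). next_sample n A t s j) x)"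
proof -
  have "pmf (paired_memory n A (Suc t)) u = measure_pmf.expectation (pair_signs n)
     (\<lambda>Y. \<Sum>x\<in>{x \<in> D. (\<lambda>(s, j). step A t s j) x = u}.
        (\<lambda>(s, j). pmf (memory_after (paired_sample n Y) A t) s
            * pmf (paired_sample n Y (choice A t s)) j) x)"
    unfolding pmf_paired_memory D_def
    by (intro integral_cong_AE AE_pmfI
        pmf_memory_after_Suc[OF assms(3) set_pmf_paired_sample[OF assms(2)]]) auto
  also have "\<dots> = (\<Sum>x\<in>{x \<in> D. (\<lambda>(s, j). step A t s j) x = u}. (\<lambda>(s, j). next_sample n A t s j) x)"
    by (subst Bochner_Integration.integral_sum) (auto simp: next_sample_def intro!: sum.cong)
  finally show ?thesis .
qed

lemma pmf_null_memory_Suc: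
  fixes n M :: nat
  defines "D \<equiv> {s :: bool list. length s = M} \<times> {1..2 * n}"
  assumes "n \<ge> 1" "uses_bits n M A"
  shows "pmf (null_memory n A (Suc t)) u =
    (\<Sum>x\<in>{x \<in> D. (\<lambda>(s, j). step A t s j) x = u}. (\<lambda>(s, j). pmf (null_memory n A t) s / (2 * n)) x)"
  unfolding null_memory_def D_def
  by (subst pmf_memory_after_Suc[OF assms(3)]) (use assms(2) in \<open>auto intro!: sum.cong\<close>)

lemma next_sample_nonneg: "next_sample n A t s j \<ge> 0"
  unfolding next_sample_def by (intro integral_nonneg_AE AE_pmfI) auto

lemma next_sample_le: "next_sample n A t s j \<le> pmf (paired_memory n A t) s"
  unfolding next_sample_def pmf_paired_memory
  by (intro integral_mono_AE AE_pmfI mult_left_le) (auto simp: pmf_le_1)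

text \<open>For X = 0 every sample in the domain has positive probability, so any transition
  possible for X = 1 is possible there too. This guards against the convention that
  \<open>ln (p / 0)\<close> is 0, which would falsify the relative entropy.\<close>

lemma paired_memory_absolutely_continuous:
  assumes "n \<ge> 1" "uses_bits n M A" "pmf (null_memory n A t) s = 0"
  shows "pmf (paired_memory n A t) s = 0"
  using assms(3)
proof (induction t arbitrary: s)
  case 0
  then show ?case by (simp add: null_memory_def pmf_paired_memory)
next
  case (Suc t)
  have "next_sample n A t s' j = 0"
    if "step A t s' j = s" "length s' = M" "j \<in> {1..2 * n}" for s' j
  proof -
    have "pmf (null_memory n A t) s' / (2 * n) = 0"
      using Suc.prems that finite_bit_strings[of M]
      unfolding pmf_null_memory_Suc[OF assms(1,2)]
      by (subst (asm) sum_nonneg_eq_0_iff) auto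
    then have "pmf (paired_memory n A t) s' = 0" using assms(1) by (intro Suc.IH) auto
    then show ?thesis using next_sample_nonneg next_sample_le by (metis order_antisym)
  qed
  then show ?case
    unfolding pmf_paired_memory_Suc[OF assms(1,2)] by (intro sum.neutral) auto
qed

section \<open>Joint law of memory state and next sample\<close>

lemma query_sign_eq:
  assumes "Y \<in> set_pmf (pair_signs n)" "w \<in> {1..2 * n}"
  shows "query_sign n Y w = (if odd w then 1 else -1) * Y ((w + 1) div 2)"
proof -
  have k: "(w + 1) div 2 \<in> {1..n}" using assms(2) by auto
  have "w \<in> set1 n Y \<longleftrightarrow> (odd w \<longleftrightarrow> Y ((w + 1) div 2) = 1)"
  proof (cases "odd w")
    case True
    then obtain m where "w = 2 * m + 1" by (elim oddE)
    then have w: "w = 2 * Suc m - 1" "(w + 1) div 2 = Suc m" by auto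
    have "2 * Suc m - 1 = 2 * i - 1 \<longleftrightarrow> i = Suc m" "2 * Suc m - 1 \<noteq> 2 * i" for i by presburger+
    then show ?thesis using True k unfolding w(2) set1_def w(1) by auto
  next
    case False
    then obtain m where "w = 2 * m" by (auto elim: evenE)
    then have w: "w = 2 * m" "(w + 1) div 2 = m" by auto
    \<comment> \<open>At \<open>i = 0\<close> truncated subtraction would make
      \<open>2 * i - 1\<close> equal to 0, an even number.\<close>
    have "i \<ge> 1 \<Longrightarrow> 2 * m \<noteq> 2 * i - 1" for i by presburger
    then show ?thesis using False k unfolding w(2) set1_def w(1) by auto
  qed
  then show ?thesis
    unfolding query_sign_def using pair_signs_cases[OF assms(1) k]
    by (cases "odd w") (simp_all only: if_True if_False; force)+
qed

text \<open>The query sign is Y_k up to a factor fixed by the parity of the query, so the sample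
  density is affine in Y_i Y_k. Averaging therefore leaves only the state probability and one
  correlation, with opposite signs on the two elements of a pair.\<close>

lemma next_sample_eq:
  fixes n t :: nat and A :: streaming_alg and s :: "bool list"
  defines "k \<equiv> (choice A t s + 1) div 2"
  defines "C \<equiv> \<lambda>i. (if odd (choice A t s) then 1 else -1) *
     measure_pmf.expectation (pair_signs n)
       (\<lambda>Y. pmf (memory_after (paired_sample n Y) A t) s * (Y i * Y k))"
  assumes n: "n \<ge> 1" and w: "choice A t s \<in> {1..2 * n}" and i: "i \<in> {1..n}"
  shows "next_sample n A t s (2 * i - 1) = (pmf (paired_memory n A t) s + C i) / (2 * n)"
    and "next_sample n A t s (2 * i) = (pmf (paired_memory n A t) s - C i) / (2 * n)"
proof -
  let ?E = "measure_pmf.expectation (pair_signs n)"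
  let ?m = "\<lambda>Y. pmf (memory_after (paired_sample n Y) A t) s"
  define \<sigma> :: real where "\<sigma> = (if odd (choice A t s) then 1 else -1)"
  \<comment> \<open>\<tau> is 1 for the odd and -1 for the even element of the pair.\<close>
  have eq: "next_sample n A t s j = (pmf (paired_memory n A t) s + \<tau> * C i) / (2 * n)"
    if "\<And>Y z. paired_density n Y z j = (1 + \<tau> * (Y i * z)) / (2 * n)" for j \<tau>
  proof -
    have "next_sample n A t s j = ?E (\<lambda>Y. (?m Y + \<tau> * \<sigma> * (?m Y * (Y i * Y k))) / (2 * n))"
      unfolding next_sample_def
    proof (intro integral_cong_AE AE_pmfI)
      fix Y assume Y: "Y \<in> set_pmf (pair_signs n)"
      show "?m Y * pmf (paired_sample n Y (choice A t s)) j =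
          (?m Y + \<tau> * \<sigma> * (?m Y * (Y i * Y k))) / (2 * n)"
        unfolding pmf_paired_sample[OF n Y] that query_sign_eq[OF Y w] \<sigma>_def[symmetric] k_def[symmetric]
        by (simp add: algebra_simps)
    qed auto
    also have "\<dots> = (pmf (paired_memory n A t) s + \<tau> * C i) / (2 * n)"
      by (simp add: C_def pmf_paired_memory \<sigma>_def)
    finally show ?thesis .
  qed
  obtain m where m: "i = Suc m" using i by (cases i) auto
  show "next_sample n A t s (2 * i - 1) = (pmf (paired_memory n A t) s + C i) / (2 * n)"
    using eq[of "2 * i - 1" 1] i by (simp add: paired_density_def m)
  show "next_sample n A t s (2 * i) = (pmf (paired_memory n A t) s - C i) / (2 * n)"
    using eq[of "2 * i" "-1"] i by (simp add: paired_density_def m)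
qed

text \<open>The chain rule for one state: the first term is the old contribution of
  \<open>s\<close>, the second bounds the divergence of the conditional sample law from uniform,
  weighted by \<open>P\<close>.\<close>

lemma sum_next_sample_le:
  fixes n M t :: nat and A :: streaming_alg and s :: "bool list"
  defines "P \<equiv> pmf (paired_memory n A t) s" and "Q \<equiv> pmf (null_memory n A t) s"
  assumes n: "n \<ge> 1" and A: "uses_bits n M A" and s: "length s = M"
  shows "(\<Sum>j\<in>{1..2 * n}. next_sample n A t s j * ln (next_sample n A t s j / (Q / (2 * n))))
    \<le> P * ln (P / Q) + P * (1 + 2 * ln (2 / P)) / n"
proof (cases "P = 0")
  case True
  then have "next_sample n A t s j = 0" for j
    using next_sample_nonneg[of n A t s j] next_sample_le[of n A t s j] by (simp add: P_def)
  then show ?thesis using True by simp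
next
  case False
  then have P: "P > 0" by (simp add: P_def pmf_pos)
  have "Q \<noteq> 0" using paired_memory_absolutely_continuous[OF n A] False by (auto simp: P_def Q_def)
  then have Q: "Q > 0" by (simp add: Q_def pmf_pos)
  have w: "choice A t s \<in> {1..2 * n}" using A s by (simp add: uses_bits_def)
  define k where "k = (choice A t s + 1) div 2"
  have k: "k \<in> {1..n}" using w by (auto simp: k_def)
  define C where "C i = measure_pmf.expectation (pair_signs n)
       (\<lambda>Y. pmf (memory_after (paired_sample n Y) A t) s * (Y i * Y k))" for i
  define \<sigma> :: real where "\<sigma> = (if odd (choice A t s) then 1 else -1)"
  define r where "r = next_sample n A t s"
  have r: "r (2 * i - 1) = (P + \<sigma> * C i) / (2 * n)" "r (2 * i) = (P - \<sigma> * C i) / (2 * n)"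
    if "i \<in> {1..n}" for i
    using next_sample_eq[OF n w that] by (simp_all add: r_def P_def \<sigma>_def C_def k_def)
  have r0: "r j \<ge> 0" for j by (simp add: r_def next_sample_nonneg)
  \<comment> \<open>This replaces relative entropy by chi-square divergence:
    \<open>2 * n * r j / P\<close> is the ratio of the conditional sample probability to the uniform
    one, and its logarithm is at most the ratio minus 1.\<close>
  have "r j * ln (r j / (Q / (2 * n))) \<le> r j * ln (P / Q) + r j * (2 * n * r j / P - 1)" for j
  proof (cases "r j = 0")
    case False
    then have rj: "r j > 0" using r0[of j] by simp
    have "r j / (Q / (2 * n)) = (P / Q) * (2 * n * r j / P)" using P by simp
    then have "ln (r j / (Q / (2 * n))) = ln (P / Q) + ln (2 * n * r j / P)"
      using P Q rj n by (simp only:) (rule ln_mult_pos, auto)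
    also have "ln (2 * n * r j / P) \<le> 2 * n * r j / P - 1"
      using P rj n by (intro ln_le_minus_one) auto
    finally show ?thesis using rj by (simp flip: distrib_left)
  qed simp
  then have "(\<Sum>j\<in>{1..2 * n}. r j * ln (r j / (Q / (2 * n))))
      \<le> (\<Sum>j\<in>{1..2 * n}. r j * ln (P / Q) + r j * (2 * n * r j / P - 1))"
    by (rule sum_mono)
  also have "\<dots> = (\<Sum>i\<in>{1..n}. P / n * ln (P / Q) + (C i)\<^sup>2 / (P * n))"
    unfolding sum_paired
  proof (intro sum.cong refl)
    fix i assume i: "i \<in> {1..n}"
    have \<sigma>: "(\<sigma> * x)\<^sup>2 = x\<^sup>2" for x by (simp add: \<sigma>_def)
    \<comment> \<open>The terms linear in \<open>e\<close> cancel within a pair, so only the squared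
      correlation survives.\<close>
    have pair: "(P + e) / (2 * n) * l + (P + e) / (2 * n) * (2 * n * ((P + e) / (2 * n)) / P - 1)
        + ((P - e) / (2 * n) * l + (P - e) / (2 * n) * (2 * n * ((P - e) / (2 * n)) / P - 1))
        = P / n * l + e\<^sup>2 / (P * n)" for e l
      using P n by (simp add: field_simps power2_eq_square)
    show "r (2 * i - 1) * ln (P / Q) + r (2 * i - 1) * (2 * n * r (2 * i - 1) / P - 1) +
        (r (2 * i) * ln (P / Q) + r (2 * i) * (2 * n * r (2 * i) / P - 1)) =
        P / n * ln (P / Q) + (C i)\<^sup>2 / (P * n)"
      unfolding r[OF i] pair \<sigma> ..
  qed
  also have "\<dots> = P * ln (P / Q) + (\<Sum>i\<in>{1..n}. (C i)\<^sup>2) / (P * n)"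
    using n by (simp add: sum.distrib sum_divide_distrib)
  also have "\<dots> \<le> P * ln (P / Q) + P\<^sup>2 * (1 + 2 * ln (2 / P)) / (P * n)"
    using pair_correlations_le[OF k, of "\<lambda>Y. pmf (memory_after (paired_sample n Y) A t) s"] P
    by (intro add_left_mono divide_right_mono) (auto simp: C_def P_def pmf_paired_memory pmf_le_1)
  also have "P\<^sup>2 * (1 + 2 * ln (2 / P)) / (P * n) = P * (1 + 2 * ln (2 / P)) / n"
    using P by (simp add: power2_eq_square)
  finally show ?thesis by (simp add: r_def)
qed

text \<open>Data processing discards the pair of old state and sample in favour of the new state.
  The per-state bounds are then summed, and the entropy of the memory controls the logarithmic
  terms.\<close>

lemma rel_entropy_memory_Suc:
  fixes n M :: nat
  defines "L \<equiv> {s :: bool list. length s = M}"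
  assumes n: "n \<ge> 1" and A: "uses_bits n M A"
  shows "rel_entropy L (pmf (paired_memory n A (Suc t))) (pmf (null_memory n A (Suc t)))
    \<le> rel_entropy L (pmf (paired_memory n A t)) (pmf (null_memory n A t)) + (3 + 2 * M) / n"
proof -
  let ?p = "pmf (paired_memory n A t)" and ?q = "pmf (null_memory n A t)"
  have L: "finite L" unfolding L_def by (rule finite_bit_strings)
  have p: "sum ?p L = 1"
    using set_pmf_paired_memory[OF n A] L by (intro sum_pmf_eq_1) (auto simp: L_def)
  have "rel_entropy L (pmf (paired_memory n A (Suc t))) (pmf (null_memory n A (Suc t)))
    = rel_entropy L
        (\<lambda>u. \<Sum>x\<in>{x \<in> L \<times> {1..2 * n}. (\<lambda>(s, j). step A t s j) x = u}.
          (\<lambda>(s, j). next_sample n A t s j) x)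
        (\<lambda>u. \<Sum>x\<in>{x \<in> L \<times> {1..2 * n}. (\<lambda>(s, j). step A t s j) x = u}.
          (\<lambda>(s, j). ?q s / (2 * n)) x)"
    unfolding L_def pmf_paired_memory_Suc[OF n A, abs_def] pmf_null_memory_Suc[OF n A, abs_def] ..
  also have "\<dots> \<le> rel_entropy (L \<times> {1..2 * n})
      (\<lambda>(s, j). next_sample n A t s j) (\<lambda>(s, j). ?q s / (2 * n))"
  proof (rule rel_entropy_image_le)
    show "(\<lambda>(s, j). step A t s j) ` (L \<times> {1..2 * n}) \<subseteq> L"
      using A by (auto simp: L_def uses_bits_def)
    fix x assume "x \<in> L \<times> {1..2 * n}"
    show "(\<lambda>(s, j). next_sample n A t s j) x = 0" if "(\<lambda>(s, j). ?q s / (2 * n)) x = 0"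
    proof -
      have "?p (fst x) = 0"
        using that n by (intro paired_memory_absolutely_continuous[OF n A]) (auto split: prod.splits)
      then show ?thesis
        using next_sample_nonneg[of n A t "fst x" "snd x"] next_sample_le[of n A t "fst x" "snd x"]
        by (auto split: prod.splits)
    qed
  qed (use L in \<open>auto simp: next_sample_nonneg\<close>)
  also have "\<dots> = (\<Sum>s\<in>L. \<Sum>j\<in>{1..2 * n}.
      next_sample n A t s j * ln (next_sample n A t s j / (?q s / (2 * n))))"
    unfolding rel_entropy_def sum.cartesian_product by (intro sum.cong) auto
  also have "\<dots> \<le> (\<Sum>s\<in>L. ?p s * ln (?p s / ?q s) + ?p s * (1 + 2 * ln (2 / ?p s)) / n)"
    using sum_next_sample_le[OF n A] by (intro sum_mono) (auto simp: L_def)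
  also have "\<dots> = rel_entropy L ?p ?q + (\<Sum>s\<in>L. ?p s * (1 + 2 * ln (2 / ?p s))) / n"
    by (simp add: rel_entropy_def sum.distrib sum_divide_distrib)
  \<comment> \<open>The sum is 1 + 2 ln 2 plus twice the entropy of the memory, which is at most M
    ln 2; ln 2 is then bounded by 1.\<close>
  also have "(\<Sum>s\<in>L. ?p s * (1 + 2 * ln (2 / ?p s))) \<le> 3 + 2 * M"
  proof -
    have ln2: "ln 2 \<le> (1::real)" using ln_le_minus_one[of "2::real"] by simp
    have "?p s * (1 + 2 * ln (2 / ?p s)) = (1 + 2 * ln 2) * ?p s + 2 * (?p s * ln (1 / ?p s))" for s
    proof (cases "?p s = 0")
      case False
      then have "?p s > 0" by (simp add: pmf_pos)
      then show ?thesis by (simp add: ln_div algebra_simps)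
    qed simp
    then have "(\<Sum>s\<in>L. ?p s * (1 + 2 * ln (2 / ?p s)))
        = (1 + 2 * ln 2) + 2 * (\<Sum>s\<in>L. ?p s * ln (1 / ?p s))"
      using p by (simp add: sum.distrib flip: sum_distrib_left)
    also have "(\<Sum>s\<in>L. ?p s * ln (1 / ?p s)) \<le> ln (card L)"
      using L p by (intro entropy_le_ln_card) auto
    also have "ln (real (card L)) = M * ln 2"
      unfolding L_def card_bit_strings by (simp add: ln_realpow)
    also have "\<dots> \<le> real M" using ln2 by (simp add: mult_left_le)
    finally show ?thesis using ln2 by simp
  qed
  finally show ?thesis by (simp add: divide_right_mono)
qed

lemma rel_entropy_memory_le:
  assumes "n \<ge> 1" "uses_bits n M A"
  shows "rel_entropy {s. length s = M} (pmf (paired_memory n A t)) (pmf (null_memory n A t))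
    \<le> t * ((3 + 2 * M) / n)"
proof (induction t)
  case 0
  have "rel_entropy {s. length s = M} (pmf (paired_memory n A 0)) (pmf (null_memory n A 0)) = 0"
    unfolding rel_entropy_def
    by (intro sum.neutral) (auto simp: null_memory_def pmf_paired_memory indicator_def)
  then show ?case by simp
next
  case (Suc t)
  then show ?case using rel_entropy_memory_Suc[OF assms, of t]
    by (simp add: distrib_right add_divide_distrib)
qed

section \<open>Error probability\<close>

lemma measure_bind_pmf_eq:
  "measure_pmf.prob (bind_pmf p f) B = measure_pmf.expectation p (\<lambda>x. measure_pmf.prob (f x) B)"
  unfolding measure_pmf_bind
  by (rule measure_pmf.measure_bind[where N = "count_space UNIV"])
    (simp_all add: measurable_measure_pmf[simplified])

text \<open>The algorithm is drawn independently of X and of the oracle, so its draw can be moved to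
  the front.\<close>

lemma error_prob_eq_expectation:
  "error_prob n T \<A> = measure_pmf.expectation \<A> (\<lambda>A. error_prob n T (return_pmf A))"
proof -
  have "streaming_game n T \<A> = \<A> \<bind> (\<lambda>A. streaming_game n T (return_pmf A))"
    unfolding streaming_game_def bind_return_pmf
    by (subst (2) bind_commute_pmf, subst (1) bind_commute_pmf) (rule refl)
  then show ?thesis
    unfolding error_prob_def by (simp add: measure_bind_pmf_eq)
qed

text \<open>Averaging, the easy direction of Yao's principle: errors all above \<open>e\<close>
  would have mean above \<open>e\<close>.\<close>

lemma exists_deterministic_error_le:
  assumes "error_prob n T \<A> \<le> e"
  shows "\<exists>A\<in>set_pmf \<A>. error_prob n T (return_pmf A) \<le> e"
proof (rule ccontr)
  assume "\<not> ?thesis"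
  then have "e < measure_pmf.expectation \<A> (\<lambda>A. error_prob n T (return_pmf A))"
    by (intro measure_pmf.expectation_greater measure_pmf.integrable_const_bound[where B = 1] AE_pmfI)
      (auto simp: error_prob_def)
  with assms show False by (simp add: error_prob_eq_expectation[of n T \<A>])
qed

lemma error_prob_return_pmf:
  "error_prob n T (return_pmf A) =
     (measure_pmf.prob (null_memory n A T) {s. guess A s}
      + measure_pmf.prob (paired_memory n A T) {s. \<not> guess A s}) / 2"
proof -
  have "streaming_game n T (return_pmf A) = pmf_of_set UNIV \<bind> (\<lambda>X.
      map_pmf (\<lambda>s. (X, guess A s)) (if X then paired_memory n A T else null_memory n A T))"
    unfolding streaming_game_def sample_oracle_def paired_memory_def null_memory_def
    by (intro bind_pmf_cong) (auto simp: bind_return_pmf map_pmf_def bind_assoc_pmf)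
  then show ?thesis
    by (simp add: error_prob_def measure_bind_pmf_eq integral_pmf_of_set UNIV_bool vimage_def)
qed

section \<open>Lower bound for deterministic algorithms\<close>

lemma deterministic_lower_bound:
  assumes n: "n \<ge> 1" and A: "uses_bits n M A" and err: "error_prob n T (return_pmf A) \<le> 1 / 3"
  shows "n / 90 \<le> real T * real M"
proof -
  let ?p = "paired_memory n A T" and ?q = "null_memory n A T"
  define L where "L = {s :: bool list. length s = M}"
  define G where "G = {s \<in> L. guess A s}"
  have L: "finite L" unfolding L_def by (rule finite_bit_strings)
  have sub: "set_pmf ?p \<subseteq> L" "set_pmf ?q \<subseteq> L"
    using set_pmf_paired_memory[OF n A] set_pmf_null_memory[OF n A] by (auto simp: L_def)
  have sums: "sum (pmf ?p) L = 1" "sum (pmf ?q) L = 1"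
    using sub L by (auto intro: sum_pmf_eq_1)
  have prob: "measure_pmf.prob r {s. guess A s} = sum (pmf r) G" if "set_pmf r \<subseteq> L" for r
  proof -
    have "measure_pmf.prob r {s. guess A s} = measure_pmf.prob r G"
      using that by (intro measure_prob_cong_0) (auto simp: G_def set_pmf_eq)
    then show ?thesis using L by (simp add: measure_measure_pmf_finite G_def)
  qed
  have "measure_pmf.prob ?p {s. \<not> guess A s} = 1 - measure_pmf.prob ?p {s. guess A s}"
    using measure_pmf.prob_compl[of "{s. guess A s}" ?p]
    by (simp add: Compl_eq_Diff_UNIV[symmetric] Collect_neg_eq)
  \<comment> \<open>Error at most 1/3 with a fair X says that the two conditional errors,
    \<open>sum (pmf ?q) G\<close> and \<open>1 - sum (pmf ?p) G\<close>, add up to at most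
    2/3.\<close>
  then have gap: "sum (pmf ?p) G - sum (pmf ?q) G \<ge> 1 / 3"
    using err unfolding error_prob_return_pmf prob[OF sub(1)] prob[OF sub(2)] by simp
  \<comment> \<open>Without memory the guess is constant and there is no gap. With M \<ge> 1 the
    additive 3 is absorbed, 3 + 2 M \<le> 5 M, and the constant becomes 1 / (18 * 5) = 1/90.\<close>
  have "M \<noteq> 0"
  proof
    assume "M = 0"
    then have "L = {[]}" by (auto simp: L_def)
    then have "G = {} \<or> G = L" by (auto simp: G_def)
    then show False using gap sums by auto
  qed
  have "1 / 18 \<le> rel_entropy L (pmf ?p) (pmf ?q)"
    using L gap sums paired_memory_absolutely_continuous[OF n A]
    by (intro rel_entropy_ge_of_gap[of L G]) (auto simp: G_def)
  also have "\<dots> \<le> T * ((3 + 2 * real M) / n)"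
    using rel_entropy_memory_le[OF n A] by (simp add: L_def)
  also have "\<dots> \<le> T * (5 * real M / n)"
  proof (rule mult_left_mono)
    show "(3 + 2 * real M) / n \<le> 5 * real M / n"
      using \<open>M \<noteq> 0\<close> by (intro divide_right_mono) linarith+
  qed simp
  also have "\<dots> = 5 * (real T * real M) / n" by simp
  finally have "1 / 18 * n \<le> 5 * (real T * real M)" using n by (simp only: pos_le_divide_eq)
  then show ?thesis by linarith
qed

theorem theorem8:
  shows "\<exists>c::real. c > 0 \<and> ( \<forall>(n::nat) (M::nat) (T::nat) (\<A> :: streaming_alg pmf).
           n \<ge> 1 \<longrightarrow> (\<forall>A\<in>set_pmf \<A>. uses_bits n M A) \<longrightarrow> error_prob n T \<A> \<le> 1 / 3 \<longrightarrow>
           real T * real M \<ge> c * real n)"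
proof (intro exI[of _ "1 / 90"] conjI allI impI)
  fix n M T :: nat and \<A> :: "streaming_alg pmf"
  assume n: "n \<ge> 1" and "\<forall>A\<in>set_pmf \<A>. uses_bits n M A" "error_prob n T \<A> \<le> 1 / 3"
  then obtain A where "uses_bits n M A" "error_prob n T (return_pmf A) \<le> 1 / 3"
    using exists_deterministic_error_le by blast
  then show "1 / 90 * real n \<le> real T * real M"
    using deterministic_lower_bound[OF n] by simp
qed simp

end
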